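(* Let $I_n$ denote the number of unlabeled interval graphs on $n$ vertices. Then $\log I_n \sim n\log n$ as $n\to\infty$, i.e. $$\lim_{n\to\infty}\frac{\log I_n}{n\log n}=1.$$
   Context: A simple undirected graph is an interval graph if it is isomorphic to the intersection graph of a family of intervals on the real line: the vertices correspond to the intervals of the family, and two distinct vertices are adjacent if and only if the corresponding intervals have nonempty intersection. The number $I_n$ of unlabeled interval graphs on $n$ vertices is the number of isomorphism classes of interval graphs with exactly $n$ vertices. Here $\log$ is the natural logarithm. *)

theory Defs
  imports
    "HOL-Analysis.Analysis"
    "Graph_Theory.Pair_Digraph"
    "Graph_Theory.Digraph_Isomorphism"
begin

definition intersection_graph :: "'i set \<Rightarrow> ('i \<Rightarrow> 'b set) \<Rightarrow> 'i pair_pre_digraph" where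
  "intersection_graph V I =
     \<lparr>pverts = V, parcs = {(u, v). u \<in> V \<and> v \<in> V \<and> u \<noteq> v \<and> I u \<inter> I v \<noteq> {}}\<rparr>"

text \<open>
  A simple undirected graph is a \<^locale>\<open>pair_graph\<close>: a finite, loopfree, symmetric digraph
  without parallel arcs. Intervals are nonempty and may be open, closed, half-open, degenerate
  or unbounded; a family of intervals may contain the same interval several times.
  The index set is in bijection with the vertices, so taking it in the vertex type loses nothing.
\<close>

definition interval_graph :: "'a pair_pre_digraph \<Rightarrow> bool" where
  "interval_graph G \<longleftrightarrow> pair_graph G \<and>
     (\<exists>(V :: 'a set) (I :: 'a \<Rightarrow> real set).
        (\<forall>v\<in>V. is_interval (I v) \<and> I v \<noteq> {}) \<and>
        digraph_iso (with_proj G) (with_proj (intersection_graph V I)))"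

text \<open>Every finite graph is isomorphic to one whose vertices are natural numbers.\<close>

definition interval_graphs :: "nat \<Rightarrow> nat pair_pre_digraph set" where
  "interval_graphs n = {G. interval_graph G \<and> card (pverts G) = n}"

definition graph_iso_rel :: "'a pair_pre_digraph set \<Rightarrow> 'a pair_pre_digraph rel" where
  "graph_iso_rel A = {(G, H). G \<in> A \<and> H \<in> A \<and> digraph_iso (with_proj G) (with_proj H)}"

definition num_unlabeled_interval_graphs :: "nat \<Rightarrow> nat" where
  "num_unlabeled_interval_graphs n = card (interval_graphs n // graph_iso_rel (interval_graphs n))"

lemma digraph_iso_with_proj_iff:
  assumes "pair_wf_digraph G"
  shows "digraph_iso (with_proj G) (with_proj H) \<longleftrightarrow>
    (\<exists>f. inj_on f (pverts G) \<and> pverts H = f ` pverts G \<and> parcs H = map_prod f f ` parcs G)"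
proof
  interpret pair_wf_digraph G by fact
  assume "digraph_iso (with_proj G) (with_proj H)"
  then obtain f where f: "pre_digraph.digraph_isomorphism (with_proj G) f"
    and H: "with_proj H = app_iso f (with_proj G)"
    by (auto simp: digraph_iso_def)
  have eq: "pverts H = iso_verts f ` pverts G" "parcs H = iso_arcs f ` parcs G"
    "iso_tail f = fst" "iso_head f = snd"
    using H by (auto simp: with_proj_def app_iso_def)
  have "iso_arcs f a = map_prod (iso_verts f) (iso_verts f) a" if "a \<in> parcs G" for a
    using f that eq by (cases a, cases "iso_arcs f a") (auto simp: pre_digraph.digraph_isomorphism_def)
  then have "parcs H = map_prod (iso_verts f) (iso_verts f) ` parcs G"
    unfolding eq by (intro image_cong) auto
  with eq f show "\<exists>f. inj_on f (pverts G) \<and> pverts H = f ` pverts G \<and> parcs H = map_prod f f ` parcs G"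
    by (intro exI[of _ "iso_verts f"]) (auto simp: pre_digraph.digraph_isomorphism_def)
next
  interpret pair_wf_digraph G by fact
  assume "\<exists>f. inj_on f (pverts G) \<and> pverts H = f ` pverts G \<and> parcs H = map_prod f f ` parcs G"
  then obtain f where f: "inj_on f (pverts G)" "pverts H = f ` pverts G"
    "parcs H = map_prod f f ` parcs G" by blast
  let ?h = "\<lparr>iso_verts = f, iso_arcs = map_prod f f, iso_head = snd, iso_tail = fst\<rparr>"
  have "inj_on (map_prod f f) (parcs G)"
    using map_prod_inj_on[OF f(1) f(1)] by (rule inj_on_subset) (auto dest: in_arcsD1 in_arcsD2)
  moreover have "wf_digraph (with_proj G)" by unfold_locales
  ultimately have "pre_digraph.digraph_isomorphism (with_proj G) ?h"
    using f(1) by (auto simp: pre_digraph.digraph_isomorphism_def)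
  moreover have "with_proj H = app_iso ?h (with_proj G)"
    using f by (auto simp: with_proj_def app_iso_def)
  ultimately show "digraph_iso (with_proj G) (with_proj H)"
    by (auto simp: digraph_iso_def)
qed

lemma interval_graph_iff:
  "interval_graph G \<longleftrightarrow> pair_graph G \<and>
     (\<exists>I :: 'a \<Rightarrow> real set. (\<forall>v\<in>pverts G. is_interval (I v) \<and> I v \<noteq> {}) \<and>
        (\<forall>u\<in>pverts G. \<forall>v\<in>pverts G. (u, v) \<in> parcs G \<longleftrightarrow> u \<noteq> v \<and> I u \<inter> I v \<noteq> {}))"
  (is "_ \<longleftrightarrow> _ \<and> ?R")
  for G :: "'a pair_pre_digraph"
proof (cases "pair_graph G")
  case True
  then interpret pair_graph G .
  have wf: "pair_wf_digraph G" by unfold_locales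
  have "(\<exists>(V :: 'a set) (I :: 'a \<Rightarrow> real set).
        (\<forall>v\<in>V. is_interval (I v) \<and> I v \<noteq> {}) \<and>
        digraph_iso (with_proj G) (with_proj (intersection_graph V I))) \<longleftrightarrow> ?R" (is "?L \<longleftrightarrow> _")
  proof
    assume ?L
    then obtain V and I :: "'a \<Rightarrow> real set" and f where
      I: "\<forall>v\<in>V. is_interval (I v) \<and> I v \<noteq> {}" and f: "inj_on f (pverts G)" "V = f ` pverts G"
      and arcs: "{(u, v). u \<in> V \<and> v \<in> V \<and> u \<noteq> v \<and> I u \<inter> I v \<noteq> {}} = map_prod f f ` parcs G"
      unfolding digraph_iso_with_proj_iff[OF wf] by (auto simp: intersection_graph_def)
    have "(u, v) \<in> parcs G \<longleftrightarrow> u \<noteq> v \<and> (I \<circ> f) u \<inter> (I \<circ> f) v \<noteq> {}"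
      if uv: "u \<in> pverts G" "v \<in> pverts G" for u v
    proof -
      have "(u, v) \<in> parcs G \<longleftrightarrow> (f u, f v) \<in> map_prod f f ` parcs G"
      proof
        assume "(f u, f v) \<in> map_prod f f ` parcs G"
        then obtain a b where ab: "(a, b) \<in> parcs G" "f u = f a" "f v = f b" by auto
        then have "a = u" "b = v"
          using inj_onD[OF f(1)] uv in_arcsD1[OF ab(1)] in_arcsD2[OF ab(1)] by simp_all
        with ab show "(u, v) \<in> parcs G" by simp
      qed force
      also have "\<dots> \<longleftrightarrow> u \<noteq> v \<and> I (f u) \<inter> I (f v) \<noteq> {}"
        unfolding arcs[symmetric] using f uv by (auto dest: inj_onD)
      finally show ?thesis by simp
    qed
    with I f(2) show ?R by (intro exI[of _ "I \<circ> f"]) auto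
  next
    assume ?R
    then obtain I :: "'a \<Rightarrow> real set" where I: "\<forall>v\<in>pverts G. is_interval (I v) \<and> I v \<noteq> {}"
      "\<forall>u\<in>pverts G. \<forall>v\<in>pverts G. (u, v) \<in> parcs G \<longleftrightarrow> u \<noteq> v \<and> I u \<inter> I v \<noteq> {}"
      by blast
    have "parcs (intersection_graph (pverts G) I) = parcs G"
      using I(2) by (auto simp: intersection_graph_def dest: in_arcsD1 in_arcsD2)
    then have "digraph_iso (with_proj G) (with_proj (intersection_graph (pverts G) I))"
      unfolding digraph_iso_with_proj_iff[OF wf]
      by (intro exI[of _ id]) (simp add: map_prod.id intersection_graph_def)
    with I(1) show ?L by blast
  qed
  then show ?thesis
    unfolding interval_graph_def by simp
qed (simp add: interval_graph_def)

lemma equiv_graph_iso_rel: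
  assumes wf: "\<And>G. G \<in> A \<Longrightarrow> pair_wf_digraph G"
  shows "equiv A (graph_iso_rel A)"
proof (rule equivI)
  show "graph_iso_rel A \<subseteq> A \<times> A" by (auto simp: graph_iso_rel_def)
  show "refl_on A (graph_iso_rel A)"
  proof (rule refl_onI)
    fix G assume G: "G \<in> A"
    have "digraph_iso (with_proj G) (with_proj G)"
      unfolding digraph_iso_with_proj_iff[OF wf[OF G]]
      by (rule exI[of _ id]) (simp add: map_prod.id)
    with G show "(G, G) \<in> graph_iso_rel A" by (simp add: graph_iso_rel_def)
  qed
  have "wf_digraph (with_proj G)" if "G \<in> A" for G
  proof -
    interpret pair_wf_digraph G using wf that by blast
    show ?thesis by unfold_locales
  qed
  then show "sym (graph_iso_rel A)"
    by (simp add: sym_def graph_iso_rel_def digraph_iso_swap)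
  show "trans (graph_iso_rel A)"
    unfolding trans_def graph_iso_rel_def using digraph_iso_trans by fast
qed

end

theory Submission
  imports Defs "HOL-Real_Asymp.Real_Asymp"
begin

text \<open>
  Upper bound: after sorting the vertices by left endpoint, an interval graph is determined by how
  far the neighbourhood of each vertex reaches, so there are at most \<open>(n + 1) ^ n\<close> of them.

  Lower bound: take \<open>2 * m\<close> disjoint points and \<open>n - 2 * m\<close> of the \<open>m\<^sup>2\<close> intervals from one of the
  first \<open>m\<close> points to one of the last \<open>m\<close>. Once the points are labelled, the chosen set of intervals
  can be read off from the graph, and the labelling loses only a factor \<open>n ^ (2 * m)\<close>. For \<open>m\<close> about
  \<open>n / ln n\<close> this factor contributes only \<open>O(n)\<close> to the logarithm, while
  \<open>ln (m\<^sup>2 choose (n - 2 * m))\<close> is asymptotically \<open>n * ln n\<close>.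
\<close>

section \<open>Upper bound\<close>

text \<open>Choose a point in each nonempty pairwise intersection; the hull of the points chosen in \<open>I u\<close>
  is a closed interval that can replace \<open>I u\<close>.\<close>

lemma closed_interval_model:
  fixes I :: "'a \<Rightarrow> real set"
  assumes V: "finite V" and I: "\<And>v. v \<in> V \<Longrightarrow> is_interval (I v) \<and> I v \<noteq> {}"
  obtains l r :: "'a \<Rightarrow> real"
  where "\<And>u v. u \<in> V \<Longrightarrow> v \<in> V \<Longrightarrow> I u \<inter> I v \<noteq> {} \<longleftrightarrow> l u \<le> r v \<and> l v \<le> r u"
proof -
  define p where "p u v = (SOME x. x \<in> I u \<inter> I v)" for u v
  have p: "p u v \<in> I u \<inter> I v" if "I u \<inter> I v \<noteq> {}" for u v
    using that by (simp only: p_def some_in_eq not_False_eq_True)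
  \<comment> \<open>Both orders choose from the same set, so one point serves \<open>u\<close> and
    \<open>v\<close> alike.\<close>
  have p_sym: "p u v = p v u" for u v
    by (simp add: p_def conj_commute)
  define P where "P u = p u ` {v \<in> V. I u \<inter> I v \<noteq> {}}" for u
  have P: "finite (P u)" "P u \<subseteq> I u" for u
    using V p by (auto simp: P_def)
  have mem: "Min (P u) \<in> I u" "Max (P u) \<in> I u" "Min (P u) \<le> Max (P u)" if "u \<in> V" for u
  proof -
    \<comment> \<open>\<open>u\<close> meets itself, so \<open>p u u\<close> belongs to
      \<open>P u\<close>.\<close>
    have "P u \<noteq> {}" using that I[OF that] by (auto simp: P_def)
    then have "Min (P u) \<in> P u" "Max (P u) \<in> P u"
      by (rule Min_in[OF P(1)], rule Max_in[OF P(1)])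
    then show "Min (P u) \<in> I u" "Max (P u) \<in> I u" "Min (P u) \<le> Max (P u)"
      using P(2) Min_le[OF P(1)] by blast+
  qed
  have "I u \<inter> I v \<noteq> {} \<longleftrightarrow> Min (P u) \<le> Max (P v) \<and> Min (P v) \<le> Max (P u)"
    if uv: "u \<in> V" "v \<in> V" for u v
  proof
    assume ne: "I u \<inter> I v \<noteq> {}"
    then have "p u v \<in> P u" "p v u \<in> P v"
      using uv unfolding P_def by (blast intro!: imageI)+
    then have "p u v \<in> P u" "p u v \<in> P v" by (simp_all only: p_sym[of v u])
    then show "Min (P u) \<le> Max (P v) \<and> Min (P v) \<le> Max (P u)"
      using order_trans[OF Min_le[OF P(1)] Max_ge[OF P(1)]] by blast
  next
    assume le: "Min (P u) \<le> Max (P v) \<and> Min (P v) \<le> Max (P u)"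
    \<comment> \<open>The larger left end lies between the ends of both hulls, hence in both
      intervals by convexity.\<close>
    have "max (Min (P u)) (Min (P v)) \<in> I w" if "w \<in> {u, v}" for w
    proof (rule mem_is_interval_1_I)
      show "is_interval (I w)" "Min (P w) \<in> I w" "Max (P w) \<in> I w"
        using that uv I mem by auto
    qed (use that uv le mem in auto)
    then show "I u \<inter> I v \<noteq> {}" by blast
  qed
  then show thesis by (rule that)
qed

lemma bij_betw_mono_key:
  fixes l :: "'a \<Rightarrow> 'b::linorder"
  assumes "finite V"
  obtains f where "bij_betw f {..<card V} V"
    "\<And>i j. i \<le> j \<Longrightarrow> j < card V \<Longrightarrow> l (f i) \<le> l (f j)"
proof -
  obtain xs where xs: "set xs = V" "distinct xs"
    using finite_distinct_list[OF assms] by blast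
  let ?ys = "sort_key l xs"
  have ys: "distinct ?ys" "set ?ys = V" "length ?ys = card V"
    using xs distinct_card by fastforce+
  show thesis
  proof
    show "bij_betw ((!) ?ys) {..<card V} V"
      using bij_betw_nth[OF ys(1) _ ys(2)[symmetric]] ys(3) by simp
    show "l (?ys ! i) \<le> l (?ys ! j)" if "i \<le> j" "j < card V" for i j
      using sorted_nth_mono[OF sorted_sort_key[of l xs] that(1)] that ys(3) by simp
  qed
qed

lemma downward_closed_eq_lessThan:
  fixes D :: "nat set"
  assumes "finite D" and down: "\<And>i j. i \<le> j \<Longrightarrow> j \<in> D \<Longrightarrow> i \<in> D"
  shows "D = {..<card D}"
proof (cases "D = {}")
  case False
  then have "D = {..Max D}"
    using assms by (auto intro: Max_ge down[OF _ Max_in])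
  then have "D = {..<Suc (Max D)}" by (simp add: lessThan_Suc_atMost)
  then show ?thesis by (metis card_lessThan)
qed auto

text \<open>\<open>d i\<close> is an exclusive bound on the positions reached from position
  \<open>i\<close>. Only the earlier member of a pair is consulted, which makes adjacency
  symmetric.\<close>

definition code_graph :: "nat \<Rightarrow> (nat \<Rightarrow> nat) \<Rightarrow> nat pair_pre_digraph" where
  "code_graph n d =
     \<lparr>pverts = {..<n}, parcs = {(i, j). i < n \<and> j < n \<and> i \<noteq> j \<and> max i j < d (min i j)}\<rparr>"

text \<open>With the vertices sorted by left endpoint, the later neighbours of a vertex are consecutive,
  so their number determines them.\<close>

lemma interval_graph_code:
  assumes G: "G \<in> interval_graphs n"
  obtains d where "d \<in> {..<n} \<rightarrow>\<^sub>E {..n}" "digraph_iso (with_proj G) (with_proj (code_graph n d))"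
proof -
  have ig: "interval_graph G" and n: "card (pverts G) = n"
    using G by (auto simp: interval_graphs_def)
  interpret pair_graph G using ig by (simp add: interval_graph_def)
  have wf: "pair_wf_digraph G" by unfold_locales
  obtain I :: "nat \<Rightarrow> real set" where I: "\<forall>v\<in>pverts G. is_interval (I v) \<and> I v \<noteq> {}"
    and arc: "\<forall>u\<in>pverts G. \<forall>v\<in>pverts G. (u, v) \<in> parcs G \<longleftrightarrow> u \<noteq> v \<and> I u \<inter> I v \<noteq> {}"
    using ig unfolding interval_graph_iff by blast
  have fin: "finite (pverts G)" by simp
  obtain l r :: "nat \<Rightarrow> real"
    where lr: "\<And>u v. u \<in> pverts G \<Longrightarrow> v \<in> pverts G \<Longrightarrow>
      I u \<inter> I v \<noteq> {} \<longleftrightarrow> l u \<le> r v \<and> l v \<le> r u"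
    using closed_interval_model[OF fin, of I] I by blast
  obtain f where f: "bij_betw f {..<n} (pverts G)"
    and mono: "\<And>i j. i \<le> j \<Longrightarrow> j < n \<Longrightarrow> l (f i) \<le> l (f j)"
    using bij_betw_mono_key[OF fin, of l] n by metis
  have fV: "f i \<in> pverts G" if "i < n" for i
    using f that by (auto simp: bij_betw_def)
  \<comment> \<open>Earlier positions are counted too, so that \<open>D i\<close> is an initial
    segment and its cardinality is the first position out of reach.\<close>
  define D where "D i = {j. j < n \<and> l (f j) \<le> r (f i)}" for i
  define d where "d = (\<lambda>i\<in>{..<n}. card (D i))"
  have D: "j \<in> D i \<longleftrightarrow> j < card (D i)" for i j
  proof -
    have "D i = {..<card (D i)}"
    proof (rule downward_closed_eq_lessThan)
      show "a \<in> D i" if "a \<le> b" "b \<in> D i" for a b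
        using mono[of a b] that by (auto simp: D_def)
    qed (simp add: D_def)
    then show ?thesis by blast
  qed
  have code_lt: "(f i, f j) \<in> parcs G \<longleftrightarrow> j < d i" "(f j, f i) \<in> parcs G \<longleftrightarrow> j < d i"
    if "i < j" "j < n" for i j
  proof -
    have ij: "f i \<in> pverts G" "f j \<in> pverts G" "f i \<noteq> f j"
      using that fV f by (auto simp: bij_betw_def dest: inj_onD)
    have "l (f i) \<le> l (f j)" using mono that by simp
    \<comment> \<open>A nonempty interval meets itself. Together with sortedness this makes one of
      the two endpoint inequalities automatic.\<close>
    moreover have "l (f j) \<le> r (f j)"
      using lr[OF ij(2) ij(2)] I ij(2) by auto
    ultimately have "I (f i) \<inter> I (f j) \<noteq> {} \<longleftrightarrow> j \<in> D i"
      using lr[OF ij(1,2)] that by (auto simp: D_def)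
    then show "(f i, f j) \<in> parcs G \<longleftrightarrow> j < d i" "(f j, f i) \<in> parcs G \<longleftrightarrow> j < d i"
      using ij arc D that by (auto simp: d_def Int_commute)
  qed
  have code: "(f i, f j) \<in> parcs G \<longleftrightarrow> (i, j) \<in> parcs (code_graph n d)" if "i < n" "j < n" for i j
    using code_lt(1)[of i j] code_lt(2)[of j i] that arc fV
    by (cases i j rule: linorder_cases) (auto simp: code_graph_def)
  let ?g = "the_inv_into {..<n} f"
  have g: "bij_betw ?g (pverts G) {..<n}"
    using f by (rule bij_betw_the_inv_into)
  have fg: "f (?g v) = v" if "v \<in> pverts G" for v
    using f that by (metis f_the_inv_into_f_bij_betw)
  have gf: "?g (f i) = i" if "i < n" for i
    using f that by (simp add: bij_betw_def the_inv_into_f_f)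
  have "digraph_iso (with_proj G) (with_proj (code_graph n d))"
    unfolding digraph_iso_with_proj_iff[OF wf]
  proof (intro exI[of _ ?g] conjI)
    show "inj_on ?g (pverts G)" "pverts (code_graph n d) = ?g ` pverts G"
      using g by (auto simp: bij_betw_def code_graph_def)
    show "parcs (code_graph n d) = map_prod ?g ?g ` parcs G"
    proof (intro equalityI subrelI)
      fix i j assume ij: "(i, j) \<in> parcs (code_graph n d)"
      then have lt: "i < n" "j < n" by (auto simp: code_graph_def)
      then have "(f i, f j) \<in> parcs G" using ij code by simp
      then have "map_prod ?g ?g (f i, f j) \<in> map_prod ?g ?g ` parcs G"
        by (rule imageI)
      then show "(i, j) \<in> map_prod ?g ?g ` parcs G"
        using lt gf by simp
    next
      fix i j assume "(i, j) \<in> map_prod ?g ?g ` parcs G"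
      then obtain u v where uv: "(u, v) \<in> parcs G" "i = ?g u" "j = ?g v" by auto
      then have V: "u \<in> pverts G" "v \<in> pverts G"
        by (auto dest: in_arcsD1 in_arcsD2)
      then have "i < n" "j < n" using uv g by (auto simp: bij_betw_def)
      with V uv fg code show "(i, j) \<in> parcs (code_graph n d)" by metis
    qed
  qed
  moreover have "card (D i) \<le> n" for i
    using card_mono[of "{..<n}" "D i"] by (auto simp: D_def)
  then have "d \<in> {..<n} \<rightarrow>\<^sub>E {..n}" by (auto simp: d_def)
  ultimately show thesis using that by blast
qed

lemma interval_graphs_wf: "G \<in> interval_graphs n \<Longrightarrow> pair_wf_digraph G"
  by (auto simp: interval_graphs_def interval_graph_def pair_graph_def pair_fin_digraph_def
      pair_digraph_def)

lemma equiv_interval_graphs: "equiv (interval_graphs n) (graph_iso_rel (interval_graphs n))"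
  using equiv_graph_iso_rel interval_graphs_wf by blast

text \<open>Classes whose representatives share a code are equal, so classes inject into codes.
  Finiteness has to come from this injection: for positive \<open>n\<close> the set
  \<open>interval_graphs n\<close> is infinite, as any \<open>n\<close> naturals may be the
  vertices.\<close>

lemma
  shows finite_unlabeled_interval_graphs:
      "finite (interval_graphs n // graph_iso_rel (interval_graphs n))" (is "finite ?Q")
    and num_unlabeled_interval_graphs_le: "num_unlabeled_interval_graphs n \<le> Suc n ^ n"
proof -
  let ?R = "graph_iso_rel (interval_graphs n)" and ?D = "{..<n} \<rightarrow>\<^sub>E {..n}"
  define rep where "rep C = (SOME G. G \<in> C)" for C :: "nat pair_pre_digraph set"
  have rep: "rep C \<in> C" if "C \<in> ?Q" for C
    using in_quotient_imp_non_empty[OF equiv_interval_graphs that]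
    by (simp add: rep_def some_in_eq)
  then have rep_in: "rep C \<in> interval_graphs n" if "C \<in> ?Q" for C
    using in_quotient_imp_subset[OF equiv_interval_graphs that] that by blast
  have "\<forall>C\<in>?Q. \<exists>d\<in>?D. digraph_iso (with_proj (rep C)) (with_proj (code_graph n d))"
    using rep_in interval_graph_code by metis
  then obtain c where c: "\<And>C. C \<in> ?Q \<Longrightarrow> c C \<in> ?D"
    "\<And>C. C \<in> ?Q \<Longrightarrow> digraph_iso (with_proj (rep C)) (with_proj (code_graph n (c C)))"
    by metis
  have inj: "inj_on c ?Q"
  proof (rule inj_onI)
    fix C C' assume C: "C \<in> ?Q" "C' \<in> ?Q" "c C = c C'"
    have "wf_digraph (with_proj (rep C'))"
    proof -
      interpret pair_wf_digraph "rep C'" using interval_graphs_wf rep_in C(2) by blast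
      show ?thesis by unfold_locales
    qed
    then have "digraph_iso (with_proj (code_graph n (c C'))) (with_proj (rep C'))"
      using c(2)[OF C(2)] by (simp add: digraph_iso_swap)
    then have "digraph_iso (with_proj (rep C)) (with_proj (rep C'))"
      using c(2)[OF C(1)] C(3) digraph_iso_trans by metis
    then have "(rep C, rep C') \<in> ?R"
      using rep_in C by (simp add: graph_iso_rel_def)
    then show "C = C'"
      using quotient_eqI[OF equiv_interval_graphs C(1,2)] rep C by blast
  qed
  have D: "finite ?D" "card ?D = Suc n ^ n"
    by (auto simp: finite_PiE card_PiE)
  have sub: "c ` ?Q \<subseteq> ?D" using c(1) by blast
  show "finite ?Q" using inj_on_finite[OF inj sub D(1)] .
  show "num_unlabeled_interval_graphs n \<le> Suc n ^ n"
    using card_inj_on_le[OF inj sub D(1)] D(2) by (simp add: num_unlabeled_interval_graphs_def)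
qed

section \<open>Lower bound\<close>

definition spans :: "nat \<Rightarrow> nat set set" where
  "spans m = (\<lambda>(a, b). {a..m + b}) ` ({..<m} \<times> {..<m})"

lemma finite_spans [simp]: "finite (spans m)"
  by (simp add: spans_def)

lemma card_spans: "card (spans m) = m\<^sup>2"
proof -
  \<comment> \<open>Left ends lie below \<open>m\<close> and right ends do not, so every set is
    nonempty and determines both its ends.\<close>
  have "inj_on (\<lambda>(a, b). {a..m + b}) ({..<m} \<times> {..<m})"
    by (rule inj_onI) auto
  then show ?thesis by (simp add: spans_def card_image power2_eq_square)
qed

text \<open>The vertices below \<open>2 * m\<close> are the points \<open>0, \<dots>, 2 * m - 1\<close>; vertex \<open>v\<close> above is the real
  interval spanned by \<open>e v\<close>, so that \<open>e v\<close> can be read off from the neighbours of \<open>v\<close>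
  among the points.\<close>

definition span_interval :: "nat \<Rightarrow> (nat \<Rightarrow> nat set) \<Rightarrow> nat \<Rightarrow> real set" where
  "span_interval m e v = (if v < 2 * m then {real v} else {real (Min (e v))..real (Max (e v))})"

definition span_graph :: "nat \<Rightarrow> nat \<Rightarrow> (nat \<Rightarrow> nat set) \<Rightarrow> nat pair_pre_digraph" where
  "span_graph n m e = intersection_graph {..<n} (span_interval m e)"

text \<open>\<open>t\<close> names the points. Traces are sets of indices rather than of vertices,
  so they can be compared across isomorphic graphs.\<close>

definition point_traces :: "nat \<Rightarrow> 'a pair_pre_digraph \<Rightarrow> (nat \<Rightarrow> 'a) \<Rightarrow> nat set set" where
  "point_traces k H t = (\<lambda>v. {i. i < k \<and> (v, t i) \<in> parcs H}) ` (pverts H - t ` {..<k})"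

lemma spansD:
  assumes "s \<in> spans m"
  shows "s = {Min s..Max s}" "Min s \<le> Max s" "s \<subseteq> {..<2 * m}"
proof -
  obtain a b where ab: "s = {a..m + b}" "a < m" "b < m"
    using assms by (auto simp: spans_def)
  then have "Min s = a" "Max s = m + b"
    by (auto intro!: Min_eqI Max_eqI)
  with ab show "s = {Min s..Max s}" "Min s \<le> Max s" "s \<subseteq> {..<2 * m}" by auto
qed

lemma span_graph_in_interval_graphs:
  assumes e: "\<And>v. 2 * m \<le> v \<Longrightarrow> v < n \<Longrightarrow> e v \<in> spans m"
  shows "span_graph n m e \<in> interval_graphs n"
proof -
  let ?G = "span_graph n m e"
  have "pair_graph ?G"
  proof
    show "finite (pverts ?G)" by (simp add: span_graph_def intersection_graph_def)
    have "parcs ?G \<subseteq> {..<n} \<times> {..<n}"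
      by (auto simp: span_graph_def intersection_graph_def)
    then show "finite (parcs ?G)" by (rule finite_subset) auto
    show "symmetric (with_proj ?G)"
      by (auto simp: span_graph_def intersection_graph_def symmetric_def sym_def arcs_ends_def
          arc_to_ends_def)
  qed (auto simp: span_graph_def intersection_graph_def)
  moreover have "is_interval (span_interval m e v) \<and> span_interval m e v \<noteq> {}" if "v < n" for v
    using e[of v] that spansD[of "e v" m] by (auto simp: span_interval_def is_interval_cc is_interval_1)
  ultimately show ?thesis
    unfolding interval_graphs_def interval_graph_iff
    by (auto simp: span_graph_def intersection_graph_def intro!: exI[of _ "span_interval m e"])
qed

lemma point_traces_span_graph:
  assumes "2 * m \<le> n" and e: "\<And>v. 2 * m \<le> v \<Longrightarrow> v < n \<Longrightarrow> e v \<in> spans m"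
  shows "point_traces (2 * m) (span_graph n m e) id = e ` {2 * m..<n}"
proof -
  have "{i. i < 2 * m \<and> (v, id i) \<in> parcs (span_graph n m e)} = e v" if "v \<in> {2 * m..<n}" for v
  proof -
    have v: "e v \<in> spans m" using e that by simp
    \<comment> \<open>\<open>v\<close> is not a point, so it differs from \<open>i\<close>, and the
      singleton at \<open>i\<close> meets its interval exactly when \<open>i\<close> lies between
      the integer ends.\<close>
    have "(v, i) \<in> parcs (span_graph n m e) \<longleftrightarrow> i \<in> {Min (e v)..Max (e v)}" if "i < 2 * m" for i
      using that \<open>v \<in> _\<close> by (auto simp: span_graph_def intersection_graph_def span_interval_def)
    then show ?thesis using spansD[OF v] by auto
  qed
  moreover have "pverts (span_graph n m e) - id ` {..<2 * m} = {2 * m..<n}"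
    by (auto simp: span_graph_def intersection_graph_def)
  ultimately show ?thesis by (auto simp: point_traces_def cong: image_cong_simp)
qed

text \<open>Adjacency is preserved in both directions and the labelling is carried along by
  \<open>f\<close>, so no index changes.\<close>

lemma point_traces_iso:
  assumes wf: "pair_wf_digraph G" and f: "inj_on f (pverts G)" "pverts H = f ` pverts G"
    "parcs H = map_prod f f ` parcs G" and t: "t ` {..<k} \<subseteq> pverts G"
  shows "point_traces k H (f \<circ> t) = point_traces k G t"
proof -
  interpret pair_wf_digraph G by fact
  have "(f u, f v) \<in> parcs H \<longleftrightarrow> (u, v) \<in> parcs G" if "u \<in> pverts G" "v \<in> pverts G" for u v
  proof
    assume "(f u, f v) \<in> parcs H"
    then obtain a b where ab: "(a, b) \<in> parcs G" "f u = f a" "f v = f b" using f by auto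
    then have "a = u" "b = v"
      using inj_onD[OF f(1)] that in_arcsD1[OF ab(1)] in_arcsD2[OF ab(1)] by simp_all
    with ab show "(u, v) \<in> parcs G" by simp
  qed (use f in force)
  then have "{i. i < k \<and> (f v, (f \<circ> t) i) \<in> parcs H} = {i. i < k \<and> (v, t i) \<in> parcs G}"
    if "v \<in> pverts G" for v
    using that t by (auto simp: image_subset_iff)
  moreover have "pverts H - (f \<circ> t) ` {..<k} = f ` (pverts G - t ` {..<k})"
    using f t
    by (simp add: image_comp[symmetric] inj_on_image_set_diff[OF f(1)] del: image_comp o_apply)
  ultimately show ?thesis
    unfolding point_traces_def by (auto simp: image_image cong: image_cong_simp)
qed

text \<open>An unlabeled graph together with the images of the \<open>2 * m\<close> points determines the chosen set
  of spans, and there are at most \<open>n ^ (2 * m)\<close> possible images.\<close>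

lemma num_unlabeled_interval_graphs_ge:
  assumes mn: "2 * m \<le> n"
  shows "m\<^sup>2 choose (n - 2 * m) \<le> num_unlabeled_interval_graphs n * n ^ (2 * m)"
proof -
  let ?A = "interval_graphs n"
  let ?R = "graph_iso_rel ?A"
  let ?Q = "?A // ?R"
  define F where "F = {S. S \<subseteq> spans m \<and> card S = n - 2 * m}"
  \<comment> \<open>There are as many vertices above the points as spans in \<open>S\<close>, so
    each span can be given one vertex.\<close>
  have "\<exists>e. e ` {2 * m..<n} = S" if "S \<in> F" for S
  proof -
    have "finite S" "card {2 * m..<n} = card S"
      using that by (auto simp: F_def intro: finite_subset[OF _ finite_spans])
    then show ?thesis
      using finite_same_card_bij[of "{2 * m..<n}" S] by (auto simp: bij_betw_def)
  qed
  then obtain e where e: "\<And>S. S \<in> F \<Longrightarrow> e S ` {2 * m..<n} = S" by metis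
  define G where "G S = span_graph n m (e S)" for S
  have e_spans: "e S v \<in> spans m" if "S \<in> F" "2 * m \<le> v" "v < n" for S v
    using e[OF that(1)] that by (auto simp: F_def)
  have G_in: "G S \<in> ?A" if "S \<in> F" for S
    unfolding G_def using e_spans that by (intro span_graph_in_interval_graphs) auto
  have traces: "point_traces (2 * m) (G S) id = S" if "S \<in> F" for S
    unfolding G_def using point_traces_span_graph[OF mn] e_spans e that by metis
  define cls where "cls S = ?R `` {G S}" for S
  have cls: "cls S \<in> ?Q" if "S \<in> F" for S
    unfolding cls_def using G_in that by (intro quotientI)
  define rep where "rep C = (SOME H. H \<in> C)" for C :: "nat pair_pre_digraph set"
  have rep: "rep C \<in> C" if "C \<in> ?Q" for C
    using in_quotient_imp_non_empty[OF equiv_interval_graphs that]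
    by (simp add: rep_def some_in_eq)
  then have rep_in: "rep C \<in> ?A" if "C \<in> ?Q" for C
    using in_quotient_imp_subset[OF equiv_interval_graphs that] that by blast
  have "\<exists>f. inj_on f (pverts (G S)) \<and> pverts (rep (cls S)) = f ` pverts (G S) \<and>
      parcs (rep (cls S)) = map_prod f f ` parcs (G S)" if "S \<in> F" for S
  proof -
    have "(G S, rep (cls S)) \<in> ?R"
      using rep[OF cls[OF that]] by (simp add: cls_def)
    then show ?thesis
      by (simp add: graph_iso_rel_def digraph_iso_with_proj_iff[OF interval_graphs_wf[OF G_in[OF that]]])
  qed
  then obtain f where f: "\<And>S. S \<in> F \<Longrightarrow> inj_on (f S) (pverts (G S))"
    "\<And>S. S \<in> F \<Longrightarrow> pverts (rep (cls S)) = f S ` pverts (G S)"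
    "\<And>S. S \<in> F \<Longrightarrow> parcs (rep (cls S)) = map_prod (f S) (f S) ` parcs (G S)"
    by metis
  have verts: "id ` {..<2 * m} \<subseteq> pverts (G S)" for S
    using mn by (auto simp: G_def span_graph_def intersection_graph_def)
  \<comment> \<open>\<open>f S\<close> maps \<open>G S\<close> isomorphically onto the
    representative of its class. Its values on the points suffice to recover \<open>S\<close>, and
    restricting it to them leaves finitely many choices.\<close>
  define h where "h S = (cls S, restrict (f S) {..<2 * m})" for S
  have recover: "point_traces (2 * m) (rep (fst (h S))) (snd (h S)) = S" if S: "S \<in> F" for S
  proof -
    have "point_traces (2 * m) (rep (cls S)) (restrict (f S) {..<2 * m})
        = point_traces (2 * m) (rep (cls S)) (f S \<circ> id)"
      by (auto simp: point_traces_def)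
    also have "\<dots> = S"
      using point_traces_iso[OF interval_graphs_wf[OF G_in[OF S]] f(1-3)[OF S] verts] traces[OF S]
      by simp
    finally show ?thesis by (simp add: h_def)
  qed
  \<comment> \<open>Representatives may have different vertex sets, so the target of the labelling
    depends on the class.\<close>
  let ?P = "SIGMA C:?Q. {..<2 * m} \<rightarrow>\<^sub>E pverts (rep C)"
  have fin: "finite (pverts (rep C))" "card (pverts (rep C)) = n" if "C \<in> ?Q" for C
  proof -
    have "rep C \<in> ?A" using rep_in that by blast
    then interpret pair_graph "rep C" by (simp add: interval_graphs_def interval_graph_def)
    show "finite (pverts (rep C))" by simp
    show "card (pverts (rep C)) = n" using \<open>rep C \<in> ?A\<close> by (simp add: interval_graphs_def)
  qed
  have "inj_on h F"
    using recover by (intro inj_onI) metis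
  moreover have "h ` F \<subseteq> ?P"
  proof (rule image_subsetI)
    fix S assume S: "S \<in> F"
    have "f S i \<in> pverts (rep (cls S))" if "i < 2 * m" for i
      using f(2)[OF S] verts[of S] that by auto
    then show "h S \<in> ?P" using cls[OF S] by (auto simp: h_def)
  qed
  moreover have "finite ?P"
    using finite_unlabeled_interval_graphs fin by (auto intro!: finite_SigmaI finite_PiE)
  ultimately have "card F \<le> card ?P" by (rule card_inj_on_le)
  also have "card ?P = (\<Sum>C\<in>?Q. n ^ (2 * m))"
    using finite_unlabeled_interval_graphs fin
    by (subst card_SigmaI) (auto intro!: finite_PiE sum.cong simp: card_PiE)
  finally show ?thesis
    using n_subsets[OF finite_spans, of m "n - 2 * m"]
    by (simp add: F_def card_spans num_unlabeled_interval_graphs_def)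
qed

section \<open>Asymptotics\<close>

text \<open>Combines the counting bound with \<open>(N / k) ^ k \<le> N choose k\<close> for
  \<open>N = m\<^sup>2\<close> and \<open>k = n - 2 * m\<close>; enlarging the denominator
  \<open>k\<close> to \<open>n\<close> only weakens it.\<close>

lemma ln_num_unlabeled_interval_graphs_ge:
  assumes mn: "2 * m < n" and n: "n \<le> m\<^sup>2"
  shows "(real n - 2 * real m) * ln ((real m)\<^sup>2 / real n) - 2 * real m * ln (real n)
    \<le> ln (real (num_unlabeled_interval_graphs n))"
proof -
  let ?N = "n - 2 * m" and ?I = "real (num_unlabeled_interval_graphs n)"
  have m: "m > 0" using mn n by (cases m) auto
  have "((real m)\<^sup>2 / real n) ^ ?N \<le> (real (m\<^sup>2) / real ?N) ^ ?N"
    using mn by (intro power_mono) (auto intro!: divide_left_mono)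
  also have "\<dots> \<le> real (m\<^sup>2 choose ?N)"
    using n by (intro binomial_ge_n_over_k_pow_k) auto
  also have "\<dots> \<le> ?I * real n ^ (2 * m)"
    using num_unlabeled_interval_graphs_ge[of m n] mn
    by (metis less_imp_le of_nat_le_iff of_nat_mult of_nat_power)
  finally have le: "((real m)\<^sup>2 / real n) ^ ?N \<le> ?I * real n ^ (2 * m)" .
  have pos: "0 < ((real m)\<^sup>2 / real n) ^ ?N" using m mn by simp
  \<comment> \<open>A zero count would force the positive left side down to 0. Positivity lets the
    logarithm of the product split.\<close>
  then have I: "?I > 0"
    using le by (metis mult_eq_0_iff not_less of_nat_0_le_iff order_le_less)
  have "real ?N * ln ((real m)\<^sup>2 / real n) = ln (((real m)\<^sup>2 / real n) ^ ?N)"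
    using m mn by (simp add: ln_realpow)
  also have "\<dots> \<le> ln (?I * real n ^ (2 * m))"
    using le pos by (rule ln_mono)
  also have "\<dots> = ln ?I + 2 * real m * ln (real n)"
    using I mn by (simp add: ln_mult ln_realpow)
  finally show ?thesis using mn by (simp add: of_nat_diff)
qed

text \<open>Takes \<open>m\<close> to be \<open>n / ln n\<close> rounded up, then trades it for real
  bounds so that no ceiling enters the limit computation.\<close>

lemma ln_num_unlabeled_interval_graphs_eventually_ge:
  "\<forall>\<^sub>F n in sequentially.
    (real n - 2 * (real n / ln (real n) + 1)) * ln (real n / (ln (real n))\<^sup>2)
      - 2 * (real n / ln (real n) + 1) * ln (real n)
    \<le> ln (real (num_unlabeled_interval_graphs n))"
proof -
  \<comment> \<open>In turn these yield \<open>2 * m < n\<close>, \<open>n \<le> m\<^sup>2\<close>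
    and a positive logarithm to divide by.\<close>
  have "\<forall>\<^sub>F n in sequentially. 2 * (real n / ln (real n) + 1) < real n"
    "\<forall>\<^sub>F n in sequentially. real n \<le> (real n / ln (real n))\<^sup>2"
    "\<forall>\<^sub>F n in sequentially. ln (real n) > 0"
    by real_asymp+
  then show ?thesis
  proof eventually_elim
    case (elim n)
    define x where "x = real n / ln (real n)"
    define m where "m = nat \<lceil>x\<rceil>"
    have n: "n > 0" using elim(3) by (cases n) auto
    then have x: "x > 0" using elim(3) by (simp add: x_def)
    then have m: "x \<le> real m" "real m \<le> x + 1" unfolding m_def by linarith+
    have xm: "x\<^sup>2 \<le> (real m)\<^sup>2" using m x by (intro power_mono) auto
    have "2 * real m \<le> 2 * (x + 1)" using m by simp
    also have "\<dots> < real n" using elim(1) unfolding x_def[symmetric] .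
    finally have mn: "2 * m < n" by linarith
    have "real n \<le> (real m)\<^sup>2"
      using elim(2) xm unfolding x_def[symmetric] by (rule order_trans)
    then have nm: "n \<le> m\<^sup>2" by (metis of_nat_le_iff of_nat_power)
    have sq: "real n / (ln (real n))\<^sup>2 = x\<^sup>2 / real n"
      using n elim(3) by (simp add: x_def field_simps power2_eq_square)
    have "1 \<le> x\<^sup>2 / real n"
      using elim(2) n unfolding x_def[symmetric] by simp
    then have ln: "0 \<le> ln (x\<^sup>2 / real n)" "ln (x\<^sup>2 / real n) \<le> ln ((real m)\<^sup>2 / real n)"
      using xm n x by (auto intro!: ln_ge_zero ln_mono divide_right_mono divide_pos_pos)
    \<comment> \<open>\<open>m\<close> is replaced by \<open>x + 1\<close> outside the logarithm and
      by \<open>x\<close> inside, each time lowering the value; the product needs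
      \<open>n - 2 * m\<close> and \<open>ln (x\<^sup>2 / n)\<close> to be nonnegative.\<close>
    have "(real n - 2 * (x + 1)) * ln (x\<^sup>2 / real n) - 2 * (x + 1) * ln (real n)
      \<le> (real n - 2 * real m) * ln ((real m)\<^sup>2 / real n) - 2 * real m * ln (real n)"
      using m ln mn elim(3) by (intro diff_mono mult_mono mult_right_mono) auto
    also have "\<dots> \<le> ln (real (num_unlabeled_interval_graphs n))"
      using mn nm by (rule ln_num_unlabeled_interval_graphs_ge)
    finally show ?case by (simp only: sq x_def[symmetric])
  qed
qed

theorem mainTheorem2:
  shows "(\<lambda>n. ln (real (num_unlabeled_interval_graphs n)) / (real n * ln (real n))) \<longlonglongrightarrow> 1"
proof (rule tendsto_sandwich)
  let ?L = "\<lambda>n. (real n - 2 * (real n / ln (real n) + 1)) * ln (real n / (ln (real n))\<^sup>2)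
      - 2 * (real n / ln (real n) + 1) * ln (real n)"
  have pos: "\<forall>\<^sub>F n in sequentially. 0 < real n * ln (real n)" by real_asymp
  show "\<forall>\<^sub>F n in sequentially. ?L n / (real n * ln (real n))
      \<le> ln (real (num_unlabeled_interval_graphs n)) / (real n * ln (real n))"
    using ln_num_unlabeled_interval_graphs_eventually_ge pos
    by eventually_elim (intro divide_right_mono, auto)
  show "\<forall>\<^sub>F n in sequentially. ln (real (num_unlabeled_interval_graphs n)) / (real n * ln (real n))
      \<le> real n * ln (real (Suc n)) / (real n * ln (real n))"
    using pos
  proof eventually_elim
    case (elim n)
    have "ln (real (num_unlabeled_interval_graphs n)) \<le> real n * ln (real (Suc n))"
    \<comment> \<open>Monotonicity of \<open>ln\<close> needs a positive argument; a zero count is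
      covered by the convention \<open>ln 0 = 0\<close>.\<close>
    proof (cases "num_unlabeled_interval_graphs n = 0")
      case False
      have "ln (real (num_unlabeled_interval_graphs n)) \<le> ln (real (Suc n ^ n))"
        using num_unlabeled_interval_graphs_le[of n] False by (intro ln_mono) (auto simp del: of_nat_power)
      then show ?thesis by (simp add: ln_realpow)
    qed simp
    then show ?case using elim by (intro divide_right_mono) auto
  qed
  \<comment> \<open>The logarithm is \<open>ln n - 2 * ln (ln n)\<close>, its factor is asymptotic
    to \<open>n\<close>, and the subtracted term is only \<open>2 * n + 2 * ln n\<close>.\<close>
  show "(\<lambda>n. ?L n / (real n * ln (real n))) \<longlonglongrightarrow> 1" by real_asymp
  show "(\<lambda>n. real n * ln (real (Suc n)) / (real n * ln (real n))) \<longlonglongrightarrow> 1" by real_asymp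
qed

end
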